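(* Let $Q$ be an IPC formula and $\theta = (Z_N, \dots, Z_0)$ a finite sequence of IPC formulas, each of the form $QW$ or $QQW$ for some IPC formula $W$. Suppose some term of $\theta$ is a formula $\alpha = Q(X \supset Y)$ for IPC formulas $X, Y$, and put $\alpha_0 = QQX$, $\alpha_1 = QY$. If $\mathcal{D}(\alpha_0, \theta)$ is a theorem of IPC or $\mathcal{D}(\alpha_1, \theta)$ is a theorem of IPC, then $\mathcal{D}(\theta)$ is a theorem of IPC.
   Context: The Implicational Propositional Calculus (IPC) has formulas built from propositional variables using only $\supset$, the single inference rule modus ponens, and the axiom schemes $X \supset (Y \supset X)$, $[X \supset (Y \supset Z)] \supset [(X \supset Y) \supset (X \supset Z)]$ and $[(X \supset Y) \supset X] \supset X$. For an IPC formula $Z$ write $QZ := Z \supset Q$. For a sequence $\theta = (Z_N, \dots, Z_0)$ of IPC formulas, $\mathcal{D}(\theta) := Z_N \supset (Z_{N-1} \supset ( \cdots (Z_0 \supset Q) \cdots ))$, and for a formula $W$, $(W,\theta)$ denotes the sequence $(W, Z_N, \dots, Z_0)$, so $\mathcal{D}(W,\theta) = W \supset \mathcal{D}(\theta)$. *)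

theory Defs
  imports Main
begin

datatype 'v ipc = Var 'v | Imp "'v ipc" "'v ipc" (infixr "\<^bold>\<supset>" 65)

inductive ipc_theorem :: "'v ipc \<Rightarrow> bool" where
  ax_K: "ipc_theorem (X \<^bold>\<supset> (Y \<^bold>\<supset> X))"
| ax_S: "ipc_theorem ((X \<^bold>\<supset> (Y \<^bold>\<supset> Z)) \<^bold>\<supset> ((X \<^bold>\<supset> Y) \<^bold>\<supset> (X \<^bold>\<supset> Z)))"
| ax_Peirce: "ipc_theorem (((X \<^bold>\<supset> Y) \<^bold>\<supset> X) \<^bold>\<supset> X)"
| modus_ponens: "ipc_theorem (X \<^bold>\<supset> Y) \<Longrightarrow> ipc_theorem X \<Longrightarrow> ipc_theorem Y"

definition Qneg :: "'v ipc \<Rightarrow> 'v ipc \<Rightarrow> 'v ipc" where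
  "Qneg Q Z = (Z \<^bold>\<supset> Q)"

text \<open>A sequence $(Z_N, \dots, Z_0)$ is represented by the list with head $Z_N$ and last element
  $Z_0$, so that $(W,\theta)$ is \<open>W # \<theta>\<close>.\<close>

primrec \<D> :: "'v ipc \<Rightarrow> 'v ipc list \<Rightarrow> 'v ipc" where
  "\<D> Q [] = Q"
| "\<D> Q (Z # \<theta>) = (Z \<^bold>\<supset> \<D> Q \<theta>)"

end

theory Submission
  imports Defs
begin

text \<open>By the deduction theorem, \<open>\<D> Q \<theta>\<close> is a theorem iff \<open>Q\<close> is derivable from the terms
  of \<open>\<theta>\<close>. Both \<open>\<alpha>0\<close> and \<open>\<alpha>1\<close> are derivable from \<open>\<alpha>\<close>, so as additional hypotheses they can
  be cut. Only \<open>\<alpha>0\<close> needs Peirce's law: from \<open>(X \<supset> Y) \<supset> Q\<close> and \<open>X \<supset> Q\<close> one gets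
  \<open>(Q \<supset> Y) \<supset> Q\<close>, hence \<open>Q\<close>.\<close>

text \<open>Derivability from hypotheses. All theorems enter through the single rule
  \<open>ipc_thm\<close>, so an induction over derivations has three cases instead of one per axiom
  scheme.\<close>

inductive derives :: "'v ipc set \<Rightarrow> 'v ipc \<Rightarrow> bool" (infix "\<turnstile>" 50) for \<Gamma> where
  hyp: "A \<in> \<Gamma> \<Longrightarrow> \<Gamma> \<turnstile> A"
| ipc_thm: "ipc_theorem A \<Longrightarrow> \<Gamma> \<turnstile> A"
| mp: "\<Gamma> \<turnstile> A \<^bold>\<supset> B \<Longrightarrow> \<Gamma> \<turnstile> A \<Longrightarrow> \<Gamma> \<turnstile> B"

lemma empty_derives_iff: "{} \<turnstile> A \<longleftrightarrow> ipc_theorem A"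
proof
  show "ipc_theorem A" if "{} \<turnstile> A"
    using that by induction (simp, assumption, rule modus_ponens)
qed (rule ipc_thm)

text \<open>The deduction theorem. Prefixing \<open>A\<close> to every line of a derivation keeps it
  a derivation: \<open>ax_K\<close> handles theorems and the other hypotheses, \<open>ax_S\<close>
  handles modus ponens.\<close>

lemma derives_ImpI:
  assumes "insert A \<Gamma> \<turnstile> B"
  shows "\<Gamma> \<turnstile> A \<^bold>\<supset> B"
  using assms
proof induction
  case (hyp B)
  \<comment> \<open>The hypothesis may be \<open>A\<close> itself; the identity implication is the
    combinator term S K K.\<close>
  have "\<Gamma> \<turnstile> A \<^bold>\<supset> A"
    by (rule mp[OF mp[OF ipc_thm[OF ax_S] ipc_thm[OF ax_K]] ipc_thm[OF ax_K[of A A]]])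
  then show ?case
    using hyp by (auto intro: mp[OF ipc_thm[OF ax_K] derives.hyp])
next
  case (ipc_thm B)
  then show ?case
    by (rule mp[OF derives.ipc_thm[OF ax_K] derives.ipc_thm])
next
  case (mp B C)
  show ?case
    by (rule derives.mp[OF derives.mp[OF ipc_thm[OF ax_S]]]) (fact mp.IH)+
qed

lemma derives_mono: "\<Gamma> \<turnstile> A \<Longrightarrow> \<Gamma> \<subseteq> \<Delta> \<Longrightarrow> \<Delta> \<turnstile> A"
  by (induction rule: derives.induct) (blast intro: hyp, erule ipc_thm, blast intro: mp)

lemma derives_Imp_iff: "\<Gamma> \<turnstile> A \<^bold>\<supset> B \<longleftrightarrow> insert A \<Gamma> \<turnstile> B"
proof
  assume "\<Gamma> \<turnstile> A \<^bold>\<supset> B"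
  then have "insert A \<Gamma> \<turnstile> A \<^bold>\<supset> B"
    by (rule derives_mono) blast
  then show "insert A \<Gamma> \<turnstile> B"
    by (rule mp) (simp add: hyp)
qed (rule derives_ImpI)

text \<open>Each head of the list moves into the context by \<open>derives_Imp_iff\<close>, hence
  the induction must leave \<Gamma> arbitrary.\<close>

lemma derives_\<D>_iff: "\<Gamma> \<turnstile> \<D> Q \<theta> \<longleftrightarrow> set \<theta> \<union> \<Gamma> \<turnstile> Q"
  by (induction \<theta> arbitrary: \<Gamma>) (simp_all add: derives_Imp_iff)

lemma derives_cut:
  assumes "insert A \<Gamma> \<turnstile> B" and "\<Gamma> \<turnstile> A"
  shows "\<Gamma> \<turnstile> B"
  by (rule mp[OF derives_ImpI]) (fact assms)+

lemma derives_Qneg_Qneg_antecedent: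
  assumes "\<Gamma> \<turnstile> Qneg Q (X \<^bold>\<supset> Y)"
  shows "\<Gamma> \<turnstile> Qneg Q (Qneg Q X)"
proof -
  let ?\<Delta> = "insert (X \<^bold>\<supset> Q) \<Gamma>"
  \<comment> \<open>\<open>Q \<supset> Y\<close> is a temporary hypothesis: with it,
    \<open>X\<close> leads through \<open>Q\<close> to \<open>Y\<close>, which supplies the
    antecedent \<open>X \<supset> Y\<close> of the assumption.\<close>
  have "insert X (insert (Q \<^bold>\<supset> Y) ?\<Delta>) \<turnstile> Q"
    by (rule mp[of _ X]) (simp_all add: hyp)
  then have "insert X (insert (Q \<^bold>\<supset> Y) ?\<Delta>) \<turnstile> Y"
    by (rule mp[rotated]) (simp add: hyp)
  then have "insert (Q \<^bold>\<supset> Y) ?\<Delta> \<turnstile> X \<^bold>\<supset> Y"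
    by (rule derives_ImpI)
  then have "insert (Q \<^bold>\<supset> Y) ?\<Delta> \<turnstile> Q"
  proof (rule mp[rotated])
    show "insert (Q \<^bold>\<supset> Y) ?\<Delta> \<turnstile> (X \<^bold>\<supset> Y) \<^bold>\<supset> Q"
      using assms unfolding Qneg_def by (rule derives_mono) blast
  qed
  then have "?\<Delta> \<turnstile> (Q \<^bold>\<supset> Y) \<^bold>\<supset> Q"
    by (rule derives_ImpI)
  \<comment> \<open>Peirce's law in the instance
    \<open>((Q \<supset> Y) \<supset> Q) \<supset> Q\<close>.\<close>
  then have "?\<Delta> \<turnstile> Q"
    by (rule mp[OF ipc_thm[OF ax_Peirce]])
  then show ?thesis
    unfolding Qneg_def by (rule derives_ImpI)
qed

text \<open>Contraposition, relative to \<open>Q\<close>, of the instance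
  \<open>Y \<supset> (X \<supset> Y)\<close> of \<open>ax_K\<close>.\<close>

lemma derives_Qneg_consequent:
  assumes "\<Gamma> \<turnstile> Qneg Q (X \<^bold>\<supset> Y)"
  shows "\<Gamma> \<turnstile> Qneg Q Y"
proof -
  have "insert Y \<Gamma> \<turnstile> X \<^bold>\<supset> Y"
    by (rule mp[OF ipc_thm[OF ax_K]]) (simp add: hyp)
  moreover have "insert Y \<Gamma> \<turnstile> (X \<^bold>\<supset> Y) \<^bold>\<supset> Q"
    using assms unfolding Qneg_def by (rule derives_mono) blast
  ultimately have "insert Y \<Gamma> \<turnstile> Q"
    by (rule mp[rotated])
  then show ?thesis
    unfolding Qneg_def by (rule derives_ImpI)
qed

theorem theorem8:
  fixes Q X Y :: "'v ipc" and \<theta> :: "'v ipc list" and \<alpha> \<alpha>0 \<alpha>1 :: "'v ipc"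
  assumes "\<forall>Z \<in> set \<theta>. \<exists>W. Z = Qneg Q W \<or> Z = Qneg Q (Qneg Q W)"
    and "\<alpha> \<in> set \<theta>"
    and "\<alpha> = Qneg Q (X \<^bold>\<supset> Y)"
    and "\<alpha>0 = Qneg Q (Qneg Q X)"
    and "\<alpha>1 = Qneg Q Y"
    and "ipc_theorem (\<D> Q (\<alpha>0 # \<theta>)) \<or> ipc_theorem (\<D> Q (\<alpha>1 # \<theta>))"
  shows "ipc_theorem (\<D> Q \<theta>)"
proof -
  have \<D>_iff: "ipc_theorem (\<D> Q \<eta>) \<longleftrightarrow> set \<eta> \<turnstile> Q" for \<eta>
    using derives_\<D>_iff[of "{}" Q \<eta>] by (simp add: empty_derives_iff)
  have "set \<theta> \<turnstile> Qneg Q (X \<^bold>\<supset> Y)"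
    using assms(2,3) by (simp add: hyp)
  then have "set \<theta> \<turnstile> \<alpha>0" and "set \<theta> \<turnstile> \<alpha>1"
    using assms(4,5) derives_Qneg_Qneg_antecedent derives_Qneg_consequent by blast+
  \<comment> \<open>In either case the added hypothesis already follows from \<theta>, so
    \<open>derives_cut\<close> removes it.\<close>
  moreover have "insert \<alpha>0 (set \<theta>) \<turnstile> Q \<or> insert \<alpha>1 (set \<theta>) \<turnstile> Q"
    using assms(6) unfolding \<D>_iff by simp
  ultimately show ?thesis
    unfolding \<D>_iff using derives_cut by blast
qed

end
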